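(* There is an absolute constant $c>0$ such that for every $n\geq 3$ and every monotone sequence $\ell_1,\ldots,\ell_n$ of lines in $\mathbb{R}^3$, there is a plane $H$ that separates at least $cn^2$ of the pairs $\ell_i,\ell_j$ with $1\leq i<j\leq n$.
   Context: For two non-vertical lines $\ell_1,\ell_2$ in $\mathbb{R}^3$ whose vertical projections to $\mathbb{R}^2$ are non-parallel, let $p(\ell_1,\ell_2)$ (resp. $p(\ell_2,\ell_1)$) be the intersection of $\ell_1$ (resp. $\ell_2$) with the unique vertical line meeting both lines, and let $s(\ell_1,\ell_2)$ be the closed vertical segment $p(\ell_1,\ell_2)p(\ell_2,\ell_1)$. A non-vertical plane $H$ separates the pair $\ell_1,\ell_2$ if $H$ intersects $s(\ell_1,\ell_2)$. Write $\ell_1\prec\ell_2$ (resp. $\ell_1\succ\ell_2$) if $p(\ell_1,\ell_2)$ lies strictly below (resp. above) $p(\ell_2,\ell_1)$, and $\ell_1\preceq\ell_2$ (resp. $\succeq$) if $\ell_1\prec\ell_2$ (resp. $\succ$) or $\ell_1\cap\ell_2\neq\emptyset$. An ordered sequence of $n\geq 3$ non-vertical lines in $\mathbb{R}^2$, no three concurrent, is an $n$-cap (resp. $n$-cup) if their slopes are strictly decreasing (resp. increasing) and for all $i<j<k$ the point $\ell_i\cap\ell_k$ lies above (resp. below) $\ell_j$. A sequence $\ell_1,\ldots,\ell_n$ of non-vertical lines in $\mathbb{R}^3$ is monotone if (1) their vertical projections $\ell_1^*,\ldots,\ell_n^*$ form an $n$-cap or an $n$-cup, and (2) either $\ell_1\preceq\cdots\preceq\ell_n$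 or $\ell_1\succeq\cdots\succeq\ell_n$. *)

theory Defs
  imports "HOL-Analysis.Analysis"
begin

definition is_line :: "'a::euclidean_space set \<Rightarrow> bool" where
  "is_line L \<longleftrightarrow> affine L \<and> aff_dim L = 1"

definition is_plane :: "(real^3) set \<Rightarrow> bool" where
  "is_plane H \<longleftrightarrow> affine H \<and> aff_dim H = 2"

definition vertical_line2 :: "(real^2) set \<Rightarrow> bool" where
  "vertical_line2 L \<longleftrightarrow> (\<exists>a. L = {p. p $ 1 = a})"

definition vertical_line3 :: "(real^3) set \<Rightarrow> bool" where
  "vertical_line3 L \<longleftrightarrow> (\<exists>a b. L = {p. p $ 1 = a \<and> p $ 2 = b})"

definition nonvertical_line2 :: "(real^2) set \<Rightarrow> bool" where
  "nonvertical_line2 L \<longleftrightarrow> is_line L \<and> \<not> vertical_line2 L"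

definition nonvertical_line3 :: "(real^3) set \<Rightarrow> bool" where
  "nonvertical_line3 L \<longleftrightarrow> is_line L \<and> \<not> vertical_line3 L"

definition nonvertical_plane :: "(real^3) set \<Rightarrow> bool" where
  "nonvertical_plane H \<longleftrightarrow> is_plane H \<and> \<not> (\<exists>V. vertical_line3 V \<and> V \<subseteq> H)"

definition vproj :: "real^3 \<Rightarrow> real^2" where
  "vproj p = vector [p $ 1, p $ 2]"

definition slope :: "(real^2) set \<Rightarrow> real" where
  "slope L = (THE m. \<exists>b. L = {p. p $ 2 = m * p $ 1 + b})"

definition pt_above :: "real^2 \<Rightarrow> (real^2) set \<Rightarrow> bool" where
  "pt_above q L \<longleftrightarrow> (\<exists>r\<in>L. r $ 1 = q $ 1 \<and> r $ 2 < q $ 2)"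

definition pt_below :: "real^2 \<Rightarrow> (real^2) set \<Rightarrow> bool" where
  "pt_below q L \<longleftrightarrow> (\<exists>r\<in>L. r $ 1 = q $ 1 \<and> q $ 2 < r $ 2)"

text \<open>
  A sequence of \<open>n\<close> lines is a function on \<open>nat\<close> of which only the values at \<open>1, \<dots>, n\<close> matter.
\<close>

definition no_three_concurrent :: "nat \<Rightarrow> (nat \<Rightarrow> (real^2) set) \<Rightarrow> bool" where
  "no_three_concurrent n l \<longleftrightarrow>
     (\<forall>i j k. 1 \<le> i \<and> i < j \<and> j < k \<and> k \<le> n \<longrightarrow> l i \<inter> l j \<inter> l k = {})"

definition is_cap :: "nat \<Rightarrow> (nat \<Rightarrow> (real^2) set) \<Rightarrow> bool" where
  "is_cap n l \<longleftrightarrow> 3 \<le> n \<and> (\<forall>i\<in>{1..n}. nonvertical_line2 (l i)) \<and> no_three_concurrent n l \<and>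
     (\<forall>i j. 1 \<le> i \<and> i < j \<and> j \<le> n \<longrightarrow> slope (l j) < slope (l i)) \<and>
     (\<forall>i j k. 1 \<le> i \<and> i < j \<and> j < k \<and> k \<le> n \<longrightarrow>
        (\<exists>q. l i \<inter> l k = {q} \<and> pt_above q (l j)))"

definition is_cup :: "nat \<Rightarrow> (nat \<Rightarrow> (real^2) set) \<Rightarrow> bool" where
  "is_cup n l \<longleftrightarrow> 3 \<le> n \<and> (\<forall>i\<in>{1..n}. nonvertical_line2 (l i)) \<and> no_three_concurrent n l \<and>
     (\<forall>i j. 1 \<le> i \<and> i < j \<and> j \<le> n \<longrightarrow> slope (l i) < slope (l j)) \<and>
     (\<forall>i j k. 1 \<le> i \<and> i < j \<and> j < k \<and> k \<le> n \<longrightarrow>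
        (\<exists>q. l i \<inter> l k = {q} \<and> pt_below q (l j)))"

text \<open>
  The notions below are meaningful for two non-vertical lines with non-parallel vertical
  projections: exactly then the vertical line meeting both is unique and meets each in one point.
\<close>

definition common_vertical :: "(real^3) set \<Rightarrow> (real^3) set \<Rightarrow> (real^3) set" where
  "common_vertical L1 L2 = (THE V. vertical_line3 V \<and> V \<inter> L1 \<noteq> {} \<and> V \<inter> L2 \<noteq> {})"

definition cross_pt :: "(real^3) set \<Rightarrow> (real^3) set \<Rightarrow> real^3" where
  "cross_pt L1 L2 = (THE p. p \<in> L1 \<inter> common_vertical L1 L2)"

definition cross_seg :: "(real^3) set \<Rightarrow> (real^3) set \<Rightarrow> (real^3) set" where
  "cross_seg L1 L2 = closed_segment (cross_pt L1 L2) (cross_pt L2 L1)"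

definition separates :: "(real^3) set \<Rightarrow> (real^3) set \<Rightarrow> (real^3) set \<Rightarrow> bool" where
  "separates H L1 L2 \<longleftrightarrow> H \<inter> cross_seg L1 L2 \<noteq> {}"

definition line_prec :: "(real^3) set \<Rightarrow> (real^3) set \<Rightarrow> bool" where
  "line_prec L1 L2 \<longleftrightarrow> cross_pt L1 L2 $ 3 < cross_pt L2 L1 $ 3"

definition line_succ :: "(real^3) set \<Rightarrow> (real^3) set \<Rightarrow> bool" where
  "line_succ L1 L2 \<longleftrightarrow> cross_pt L1 L2 $ 3 > cross_pt L2 L1 $ 3"

definition line_preceq :: "(real^3) set \<Rightarrow> (real^3) set \<Rightarrow> bool" where
  "line_preceq L1 L2 \<longleftrightarrow> line_prec L1 L2 \<or> L1 \<inter> L2 \<noteq> {}"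

definition line_succeq :: "(real^3) set \<Rightarrow> (real^3) set \<Rightarrow> bool" where
  "line_succeq L1 L2 \<longleftrightarrow> line_succ L1 L2 \<or> L1 \<inter> L2 \<noteq> {}"

text \<open>
  The relations are not transitive; the chains \<open>l 1 \<preceq> \<dots> \<preceq> l n\<close> and \<open>l 1 \<succeq> \<dots> \<succeq> l n\<close> are read
  literally, as conditions on consecutive lines.
\<close>

definition monotone_lines :: "nat \<Rightarrow> (nat \<Rightarrow> (real^3) set) \<Rightarrow> bool" where
  "monotone_lines n l \<longleftrightarrow>
     (\<forall>i\<in>{1..n}. nonvertical_line3 (l i)) \<and>
     (is_cap n (\<lambda>i. vproj ` l i) \<or> is_cup n (\<lambda>i. vproj ` l i)) \<and>
     ((\<forall>i. 1 \<le> i \<and> i < n \<longrightarrow> line_preceq (l i) (l (Suc i))) \<or>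
      (\<forall>i. 1 \<le> i \<and> i < n \<longrightarrow> line_succeq (l i) (l (Suc i))))"

end

theory Submission
  imports Defs "HOL-Library.Ramsey"
begin

text \<open>
  The planes through a fixed line \<open>l k\<close> form a one-parameter family, and those separating
  \<open>l i\<close> from \<open>l j\<close> form an interval of parameters, the window of \<open>(i, j)\<close>. Among five lines of a
  cap or cup whose pairs are all crossing in the same sense (\<open>\<preceq>\<close> or \<open>\<succeq>\<close>), one line \<open>l k\<close> has the
  property that the remaining four split into two pairs with overlapping windows. By Ramsey's
  theorem and supersaturation this happens for a positive fraction of all quintuples. Whenever two
  intervals overlap, one contains the left end of the other, so for some \<open>k\<close> and some window, the
  left end of this window lies in a positive fraction of all windows of \<open>k\<close>.
\<close>

subsection \<open>Counting\<close>

text \<open>Deleting \<open>T\<close> is injective on the supersets of \<open>T\<close>.\<close>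

lemma card_supersets_le:
  assumes "finite A" "T \<subseteq> A"
  shows "card {S. S \<subseteq> A \<and> card S = r \<and> T \<subseteq> S} \<le> (card A - card T) choose (r - card T)"
proof -
  have T: "finite T"
    using assms finite_subset by blast
  have "card {S. S \<subseteq> A \<and> card S = r \<and> T \<subseteq> S} \<le> card {U. U \<subseteq> A - T \<and> card U = r - card T}"
  proof (rule card_inj_on_le)
    show "inj_on (\<lambda>S. S - T) {S. S \<subseteq> A \<and> card S = r \<and> T \<subseteq> S}"
      by (auto simp: inj_on_def)
    show "(\<lambda>S. S - T) ` {S. S \<subseteq> A \<and> card S = r \<and> T \<subseteq> S} \<subseteq> {U. U \<subseteq> A - T \<and> card U = r - card T}"
      using T by (auto simp: card_Diff_subset)
  qed (use assms in simp)
  also have "\<dots> = (card A - card T) choose (r - card T)"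
    using assms T by (simp add: n_subsets card_Diff_subset)
  finally show ?thesis .
qed

text \<open>Double counting. Every \<open>r\<close>-subset of \<open>A\<close> contains the support
  of a good pair \<open>(k, e)\<close>, and each support lies in at most
  \<open>(card A - s) choose (r - s)\<close> of these subsets. Hence there are at least
  \<open>(card A choose s) / (r choose s)\<close> good pairs, and some \<open>k\<close> gets at
  least the average share of them.\<close>

lemma supersaturation:
  fixes A :: "'a set" and K :: "'k set" and E :: "'e set" and supp :: "'k \<Rightarrow> 'e \<Rightarrow> 'a set"
  assumes fin: "finite A" "finite K" "finite E" and "s \<le> r" "r \<le> card A"
    and supp: "\<And>k e. Q k e \<Longrightarrow> supp k e \<subseteq> A \<and> card (supp k e) = s"
    and ex: "\<And>S. S \<subseteq> A \<Longrightarrow> card S = r \<Longrightarrow> \<exists>k\<in>K. \<exists>e\<in>E. Q k e \<and> supp k e \<subseteq> S"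
  shows "\<exists>k\<in>K. card A choose s \<le> card K * (r choose s) * card {e\<in>E. Q k e}"
proof (rule ccontr)
  define c where "c = (card A - s) choose (r - s)"
  define F where "F k e = {S. S \<subseteq> A \<and> card S = r \<and> supp k e \<subseteq> S}" for k e
  assume "\<not> ?thesis"
  then have small: "card K * (r choose s) * card {e\<in>E. Q k e} < card A choose s" if "k \<in> K" for k
    using that by (meson not_le)
  have F: "card (F k e) \<le> c" if "Q k e" for k e
    using card_supersets_le[OF fin(1), of "supp k e" r] supp[OF that] by (simp add: F_def c_def)
  have "c > 0"
    unfolding c_def using assms(4,5) by (simp add: zero_less_binomial_iff)
  have K: "K \<noteq> {}"
    using ex assms(5) by (metis obtain_subset_with_card_n empty_iff)
  have "{S. S \<subseteq> A \<and> card S = r} \<subseteq> (\<Union>k\<in>K. \<Union>e\<in>{e\<in>E. Q k e}. F k e)"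
  proof
    fix S assume S: "S \<in> {S. S \<subseteq> A \<and> card S = r}"
    then obtain k e where "k \<in> K" "e \<in> E" "Q k e" "supp k e \<subseteq> S"
      using ex by blast
    with S show "S \<in> (\<Union>k\<in>K. \<Union>e\<in>{e\<in>E. Q k e}. F k e)"
      unfolding F_def by blast
  qed
  then have "card {S. S \<subseteq> A \<and> card S = r} \<le> card (\<Union>k\<in>K. \<Union>e\<in>{e\<in>E. Q k e}. F k e)"
    using fin by (intro card_mono) (auto simp: F_def)
  also have "\<dots> \<le> (\<Sum>k\<in>K. card (\<Union>e\<in>{e\<in>E. Q k e}. F k e))"
    using fin(2) by (rule card_UN_le)
  also have "\<dots> \<le> (\<Sum>k\<in>K. \<Sum>e\<in>{e\<in>E. Q k e}. card (F k e))"
    using fin(3) by (intro sum_mono card_UN_le) simp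
  also have "\<dots> \<le> (\<Sum>k\<in>K. card {e\<in>E. Q k e} * c)"
  proof (intro sum_mono)
    fix k
    show "(\<Sum>e\<in>{e\<in>E. Q k e}. card (F k e)) \<le> card {e\<in>E. Q k e} * c"
      using sum_bounded_above[of "{e\<in>E. Q k e}" "\<lambda>e. card (F k e)" c] F by simp
  qed
  finally have "card A choose r \<le> (\<Sum>k\<in>K. card {e\<in>E. Q k e}) * c"
    using fin(1) by (simp add: n_subsets sum_distrib_right)
  \<comment> \<open>By \<open>choose_mult\<close> the left side equals
    \<open>(card A choose s) * c\<close>, so that \<open>c\<close> cancels.\<close>
  then have "(card A choose r) * (r choose s) \<le> (\<Sum>k\<in>K. card {e\<in>E. Q k e}) * c * (r choose s)"
    by (rule mult_le_mono1)
  then have "(card A choose s) * c \<le> (r choose s) * (\<Sum>k\<in>K. card {e\<in>E. Q k e}) * c"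
    unfolding choose_mult[OF assms(4,5)] c_def by (simp only: ac_simps)
  then have "card A choose s \<le> (r choose s) * (\<Sum>k\<in>K. card {e\<in>E. Q k e})"
    using \<open>c > 0\<close> by (metis mult_le_cancel2)
  then have "card K * (card A choose s) \<le> (\<Sum>k\<in>K. card K * (r choose s) * card {e\<in>E. Q k e})"
    by (simp add: mult.assoc flip: sum_distrib_left)
  also have "\<dots> < (\<Sum>k\<in>K. card A choose s)"
    using fin(2) K small by (intro sum_strict_mono) auto
  finally show False
    by simp
qed

text \<open>Symmetry makes \<open>P\<close> readable from the unordered edges \<open>{x, y}\<close>.
  Singleton edges coming from \<open>P x x\<close> do no harm, since cliques and independent sets
  only test distinct vertices.\<close>

lemma ramsey_symp:
  "\<exists>r. \<forall>(V :: 'a set) P. finite V \<and> r \<le> card V \<and> symp P \<longrightarrow>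
    (\<exists>R\<subseteq>V. card R = m \<and> (\<forall>x\<in>R. \<forall>y\<in>R. x \<noteq> y \<longrightarrow> P x y) \<or>
           card R = n \<and> (\<forall>x\<in>R. \<forall>y\<in>R. x \<noteq> y \<longrightarrow> \<not> P x y))"
proof -
  obtain r where r: "\<And>(V :: 'a set) E. finite V \<Longrightarrow> r \<le> card V \<Longrightarrow>
      \<exists>R\<subseteq>V. card R = m \<and> clique R E \<or> card R = n \<and> indep R E"
    using ramsey2[of m n] by blast
  show ?thesis
  proof (intro exI[of _ r] allI impI, elim conjE)
    fix V :: "'a set" and P :: "'a \<Rightarrow> 'a \<Rightarrow> bool"
    assume V: "finite V" "r \<le> card V" and sym: "symp P"
    define E where "E = {{x, y} | x y. P x y}"
    have "{x, y} \<in> E \<longleftrightarrow> P x y" for x y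
      using sympD[OF sym] by (auto simp: E_def doubleton_eq_iff)
    with r[OF V, of E]
    show "\<exists>R\<subseteq>V. card R = m \<and> (\<forall>x\<in>R. \<forall>y\<in>R. x \<noteq> y \<longrightarrow> P x y) \<or>
           card R = n \<and> (\<forall>x\<in>R. \<forall>y\<in>R. x \<noteq> y \<longrightarrow> \<not> P x y)"
      by (simp add: clique_def indep_def)
  qed
qed

lemma card_5_sorted:
  fixes T :: "'a::linorder set"
  assumes "card T = 5"
  obtains a c d e f where "T = {a, c, d, e, f}" "a < c" "c < d" "d < e" "e < f"
proof -
  have "finite T"
    using assms by (metis card.infinite zero_neq_numeral)
  define xs where "xs = sorted_list_of_set T"
  have xs: "length xs = 5" "sorted_wrt (<) xs" "set xs = T"
    using assms \<open>finite T\<close> by (auto simp: xs_def)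
  then obtain a c d e f where "xs = [a, c, d, e, f]"
    by (auto simp: numeral_eq_Suc length_Suc_conv)
  with xs show ?thesis
    by (intro that[of a c d e f]) auto
qed

subsection \<open>Lines and planes as graphs\<close>

definition graph_line2 :: "real \<Rightarrow> real \<Rightarrow> (real^2) set" where
  "graph_line2 m b = {p. p $ 2 = m * p $ 1 + b}"

definition graph_line3 :: "real \<Rightarrow> real \<Rightarrow> real \<Rightarrow> real \<Rightarrow> (real^3) set" where
  "graph_line3 m b u v = {p. p $ 2 = m * p $ 1 + b \<and> p $ 3 = u * p $ 1 + v}"

definition graph_plane :: "real \<Rightarrow> real \<Rightarrow> real \<Rightarrow> (real^3) set" where
  "graph_plane \<alpha> \<beta> \<gamma> = {p. p $ 3 = \<alpha> * p $ 1 + \<beta> * p $ 2 + \<gamma>}"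

lemma vec2_in_graph_line2 [simp]: "vector [x, y] \<in> graph_line2 m b \<longleftrightarrow> y = m * x + b"
  by (simp add: graph_line2_def)

lemma slope_graph_line2 [simp]: "slope (graph_line2 m b) = m"
  unfolding slope_def
proof (rule the_equality)
  show "\<exists>b'. graph_line2 m b = {p. p $ 2 = m * p $ 1 + b'}"
    by (auto simp: graph_line2_def)
next
  fix m' assume "\<exists>b'. graph_line2 m b = {p. p $ 2 = m' * p $ 1 + b'}"
  then obtain b' where "graph_line2 m b = graph_line2 m' b'"
    by (auto simp: graph_line2_def)
  then have "vector [0, b] \<in> graph_line2 m' b'" "vector [1, m + b] \<in> graph_line2 m' b'"
    by (metis vec2_in_graph_line2 mult_zero_right add_0,
        metis vec2_in_graph_line2 mult.right_neutral)
  then show "m' = m"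
    by simp
qed

lemma is_line_obtain_points:
  assumes "is_line L"
  obtains p q where "L = affine hull {p, q}"
proof -
  obtain B where "affine hull B = affine hull L" "of_nat (card B) = aff_dim L + 1"
    using aff_dim_basis_exists by metis
  then have "affine hull B = L" "card B = 2"
    using assms by (auto simp: is_line_def)
  then show ?thesis
    by (metis card_2_iff that)
qed

lemma vproj_image_graph_line3: "vproj ` graph_line3 m b u v = graph_line2 m b"
proof
  show "vproj ` graph_line3 m b u v \<subseteq> graph_line2 m b"
    by (auto simp: vproj_def graph_line2_def graph_line3_def)
  show "graph_line2 m b \<subseteq> vproj ` graph_line3 m b u v"
  proof
    fix q assume "q \<in> graph_line2 m b"
    then have "vector [q $ 1, q $ 2, u * q $ 1 + v] \<in> graph_line3 m b u v"
      by (simp add: graph_line2_def graph_line3_def)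
    moreover have "vproj (vector [q $ 1, q $ 2, u * q $ 1 + v]) = q"
      by (simp add: vproj_def vec_eq_iff forall_2)
    ultimately show "q \<in> vproj ` graph_line3 m b u v"
      by (metis imageI)
  qed
qed

text \<open>The assumption on the projection is stronger than \<open>L\<close> being non-vertical:
  if the first coordinate were constant on \<open>L\<close>, the projection would be a single point
  or a vertical line. So the first coordinate parametrizes \<open>L\<close>.\<close>

lemma line_eq_graph_line3:
  assumes "is_line L" "nonvertical_line2 (vproj ` L)"
  obtains m b u v where "L = graph_line3 m b u v"
proof -
  obtain p q where "L = affine hull {p, q}"
    using assms(1) by (rule is_line_obtain_points)
  then have L: "L = range (\<lambda>t. p + t *\<^sub>R (q - p))"
    by (auto simp: affine_hull_2_alt)
  show ?thesis
  proof (cases "q $ 1 = p $ 1")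
    case True
    show ?thesis
    proof (cases "q $ 2 = p $ 2")
      case True
      with \<open>q $ 1 = p $ 1\<close> have "vproj (p + t *\<^sub>R (q - p)) = vproj p" for t
        by (simp add: vproj_def)
      then have "vproj ` L = {vproj p}"
        by (simp add: L image_image)
      with assms(2) show ?thesis
        by (simp add: nonvertical_line2_def is_line_def)
    next
      case False
      have "vproj ` L = {r. r $ 1 = p $ 1}"
      proof
        show "vproj ` L \<subseteq> {r. r $ 1 = p $ 1}"
          using \<open>q $ 1 = p $ 1\<close> by (auto simp: L vproj_def)
        show "{r. r $ 1 = p $ 1} \<subseteq> vproj ` L"
        proof
          fix r :: "real^2" assume "r \<in> {r. r $ 1 = p $ 1}"
          then have "r = vproj (p + ((r $ 2 - p $ 2) / (q $ 2 - p $ 2)) *\<^sub>R (q - p))"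
            using False \<open>q $ 1 = p $ 1\<close> by (simp add: vproj_def vec_eq_iff forall_2)
          then show "r \<in> vproj ` L"
            by (auto simp: L)
        qed
      qed
      with assms(2) show ?thesis
        by (auto simp: nonvertical_line2_def vertical_line2_def)
    qed
  next
    case False
    define m where "m = (q $ 2 - p $ 2) / (q $ 1 - p $ 1)"
    define u where "u = (q $ 3 - p $ 3) / (q $ 1 - p $ 1)"
    have q: "q $ 2 = p $ 2 + m * (q $ 1 - p $ 1)" "q $ 3 = p $ 3 + u * (q $ 1 - p $ 1)"
      using False by (simp_all add: m_def u_def)
    have "L = graph_line3 m (p $ 2 - m * p $ 1) u (p $ 3 - u * p $ 1)" (is "_ = ?G")
    proof
      show "L \<subseteq> ?G"
        by (auto simp: L graph_line3_def q algebra_simps)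
      show "?G \<subseteq> L"
      proof
        fix r assume "r \<in> ?G"
        then have r: "r $ 2 = p $ 2 + m * (r $ 1 - p $ 1)" "r $ 3 = p $ 3 + u * (r $ 1 - p $ 1)"
          by (auto simp: graph_line3_def algebra_simps)
        have "r = p + ((r $ 1 - p $ 1) / (q $ 1 - p $ 1)) *\<^sub>R (q - p)"
          using False r by (simp add: vec_eq_iff forall_3 m_def u_def)
        then show "r \<in> L"
          unfolding L by (rule range_eqI)
      qed
    qed
    then show ?thesis
      by (rule that)
  qed
qed

lemma nonvertical_plane_graph_plane: "nonvertical_plane (graph_plane \<alpha> \<beta> \<gamma>)"
proof -
  let ?n = "vector [- \<alpha>, - \<beta>, 1] :: real^3"
  have eq: "graph_plane \<alpha> \<beta> \<gamma> = {p. ?n \<bullet> p = \<gamma>}"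
    by (auto simp: graph_plane_def inner_vec_def sum_3)
  have "?n $ 3 \<noteq> 0 $ 3"
    by simp
  then have "?n \<noteq> 0"
    by metis
  then have "is_plane (graph_plane \<alpha> \<beta> \<gamma>)"
    by (simp add: is_plane_def eq affine_hyperplane)
  moreover have "\<not> V \<subseteq> graph_plane \<alpha> \<beta> \<gamma>" if "vertical_line3 V" for V
  proof
    assume sub: "V \<subseteq> graph_plane \<alpha> \<beta> \<gamma>"
    from that obtain x y where "V = {p. p $ 1 = x \<and> p $ 2 = y}"
      by (auto simp: vertical_line3_def)
    then have "vector [x, y, z] \<in> V" for z
      by simp
    then have "z = \<alpha> * x + \<beta> * y + \<gamma>" for z
      using sub by (force simp: graph_plane_def)
    from this[of 0] this[of 1] show False
      by simp
  qed
  ultimately show ?thesis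
    by (auto simp: nonvertical_plane_def)
qed

section \<open>Crossing points and separation in coordinates\<close>

lemma graph_lines_cross:
  fixes m b m' b' x y :: real
  assumes "m \<noteq> m'"
  shows "y = m * x + b \<and> y = m' * x + b' \<longleftrightarrow> x = (b' - b) / (m - m') \<and> y = m * x + b"
proof -
  have "m * x + b = m' * x + b' \<longleftrightarrow> x * (m - m') = b' - b"
    by (auto simp: algebra_simps)
  then show ?thesis
    using assms by (auto simp: eq_divide_eq)
qed

text \<open>A vertical line meeting both lines stands over a common point of their projections, and
  there is exactly one such point. This settles both definite descriptions.\<close>

lemma cross_pt_graph_line3:
  fixes m b u v m' b' u' v' :: real
  assumes "m \<noteq> m'"
  defines "x \<equiv> (b' - b) / (m - m')"
  shows "cross_pt (graph_line3 m b u v) (graph_line3 m' b' u' v') =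
    vector [x, m * x + b, u * x + v]"
proof -
  let ?L = "graph_line3 m b u v" and ?L' = "graph_line3 m' b' u' v'"
  have x: "m' * x + b' = m * x + b"
    by (metis graph_lines_cross[OF assms(1)] x_def)
  have "common_vertical ?L ?L' = {p. p $ 1 = x \<and> p $ 2 = m * x + b}"
    unfolding common_vertical_def
  proof (rule the_equality)
    have "vector [x, m * x + b, u * x + v] \<in> {p. p $ 1 = x \<and> p $ 2 = m * x + b} \<inter> ?L"
      by (simp add: graph_line3_def)
    moreover have "vector [x, m * x + b, u' * x + v'] \<in> {p. p $ 1 = x \<and> p $ 2 = m * x + b} \<inter> ?L'"
      by (simp add: graph_line3_def x)
    ultimately show "vertical_line3 {p. p $ 1 = x \<and> p $ 2 = m * x + b} \<and>
      {p. p $ 1 = x \<and> p $ 2 = m * x + b} \<inter> ?L \<noteq> {} \<and>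
      {p. p $ 1 = x \<and> p $ 2 = m * x + b} \<inter> ?L' \<noteq> {}"
      unfolding vertical_line3_def by blast
  next
    fix V assume V: "vertical_line3 V \<and> V \<inter> ?L \<noteq> {} \<and> V \<inter> ?L' \<noteq> {}"
    then obtain s y where eq: "V = {p. p $ 1 = s \<and> p $ 2 = y}"
      by (auto simp: vertical_line3_def)
    with V have "y = m * s + b \<and> y = m' * s + b'"
      by (auto simp: graph_line3_def)
    then have "s = x \<and> y = m * s + b"
      unfolding x_def by (rule iffD1[OF graph_lines_cross[OF assms(1)]])
    then show "V = {p. p $ 1 = x \<and> p $ 2 = m * x + b}"
      by (simp add: eq)
  qed
  then have "p \<in> ?L \<inter> common_vertical ?L ?L' \<longleftrightarrow> p = vector [x, m * x + b, u * x + v]" for p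
    by (auto simp: graph_line3_def vec_eq_iff forall_3)
  then show ?thesis
    by (simp add: cross_pt_def)
qed

text \<open>The two factors in \<open>sep\<close> are the signed heights of the lines above the
  plane over the crossing of the projections. If they do not have the same strict sign, the plane
  passes between the two crossing points.\<close>

lemma separates_graph_plane:
  fixes m b u v m' b' u' v' :: real
  assumes "m \<noteq> m'"
  defines "x \<equiv> (b' - b) / (m - m')"
  assumes sep: "(u * x + v - (\<alpha> * x + \<beta> * (m * x + b) + \<gamma>)) *
     (u' * x + v' - (\<alpha> * x + \<beta> * (m * x + b) + \<gamma>)) \<le> 0"
  shows "separates (graph_plane \<alpha> \<beta> \<gamma>) (graph_line3 m b u v) (graph_line3 m' b' u' v')"
proof -
  define h where "h = \<alpha> * x + \<beta> * (m * x + b) + \<gamma>"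
  \<comment> \<open>Exchanging the lines leaves the crossing unchanged, so both crossing points lie
    over the same point.\<close>
  have x': "(b - b') / (m' - m) = x"
    unfolding x_def by (metis minus_diff_eq minus_divide_divide)
  have "m' * x + b' = m * x + b"
    by (metis graph_lines_cross[OF assms(1)] x_def)
  then have pts:
    "cross_pt (graph_line3 m b u v) (graph_line3 m' b' u' v') = vector [x, m * x + b, u * x + v]"
    "cross_pt (graph_line3 m' b' u' v') (graph_line3 m b u v) = vector [x, m * x + b, u' * x + v']"
    using cross_pt_graph_line3[OF assms(1), of b u v b' u' v']
      cross_pt_graph_line3[OF assms(1)[symmetric], of b' u' v' b u v]
    unfolding x' x_def[symmetric] by simp_all
  have "h \<in> closed_segment (u * x + v) (u' * x + v')"
    using sep unfolding h_def[symmetric] by (auto simp: closed_segment_eq_real_ivl mult_le_0_iff)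
  then obtain t where "0 \<le> t" "t \<le> 1" and t: "h = (1 - t) * (u * x + v) + t * (u' * x + v')"
    by (auto simp: closed_segment_def)
  then have "vector [x, m * x + b, h] \<in> closed_segment (vector [x, m * x + b, u * x + v])
      (vector [x, m * x + b, u' * x + v'] :: real^3)"
    unfolding closed_segment_def
    by (intro CollectI exI[of _ t]) (simp add: vec_eq_iff forall_3 algebra_simps)
  moreover have "vector [x, m * x + b, h] \<in> graph_plane \<alpha> \<beta> \<gamma>"
    by (simp add: graph_plane_def h_def)
  ultimately show ?thesis
    unfolding separates_def cross_seg_def pts by blast
qed

lemma graph_line2_inter_point:
  fixes m b m' b' :: real
  assumes "m \<noteq> m'"
  defines "x \<equiv> (b' - b) / (m - m')"
  shows "graph_line2 m b \<inter> graph_line2 m' b' = {vector [x, m * x + b]}"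
proof (rule set_eqI)
  fix q
  have "q \<in> graph_line2 m b \<inter> graph_line2 m' b' \<longleftrightarrow> q $ 1 = x \<and> q $ 2 = m * q $ 1 + b"
    unfolding graph_line2_def x_def using graph_lines_cross[OF assms(1)] by blast
  then show "q \<in> graph_line2 m b \<inter> graph_line2 m' b' \<longleftrightarrow> q \<in> {vector [x, m * x + b]}"
    by (auto simp: vec_eq_iff forall_2)
qed

lemma pt_above_graph_line2: "pt_above q (graph_line2 m b) \<longleftrightarrow> m * q $ 1 + b < q $ 2"
proof
  assume "m * q $ 1 + b < q $ 2"
  then show "pt_above q (graph_line2 m b)"
    unfolding pt_above_def by (intro bexI[of _ "vector [q $ 1, m * q $ 1 + b]"]) simp_all
qed (auto simp: pt_above_def graph_line2_def)

lemma pt_below_graph_line2: "pt_below q (graph_line2 m b) \<longleftrightarrow> q $ 2 < m * q $ 1 + b"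
proof
  assume "q $ 2 < m * q $ 1 + b"
  then show "pt_below q (graph_line2 m b)"
    unfolding pt_below_def by (intro bexI[of _ "vector [q $ 1, m * q $ 1 + b]"]) simp_all
qed (auto simp: pt_below_def graph_line2_def)

subsection \<open>Windows\<close>

text \<open>
  The \<open>i\<close>-th line is \<open>graph_line3 (m i) (b i) (u i) (v i)\<close>. Projective duality turns its projection
  into the point \<open>(m i, b i)\<close>, and caps and cups into sequences of points in convex position,
  \<open>0 < orient i j k\<close>. The sign of \<open>bracket i j i j\<close> tells, up to the sign of \<open>m i - m j\<close>, which of
  the lines \<open>i\<close> and \<open>j\<close> is the upper one where their projections cross.
\<close>

locale line_family =
  fixes m b u v :: "nat \<Rightarrow> real"
begin

definition orient :: "nat \<Rightarrow> nat \<Rightarrow> nat \<Rightarrow> real" where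
  "orient i j k = b i * (m j - m k) + b j * (m k - m i) + b k * (m i - m j)"

definition bracket :: "nat \<Rightarrow> nat \<Rightarrow> nat \<Rightarrow> nat \<Rightarrow> real" where
  "bracket i j k l = (m i - m j) * (v k - v l) - (b i - b j) * (u k - u l)"

text \<open>
  The plane through line \<open>k\<close> that meets line \<open>i\<close> over the point where the projections of
  \<open>i\<close> and \<open>j\<close> cross is \<open>z = u k * x + v k + theta k i j * (y - m k * x - b k)\<close>.
\<close>

definition theta :: "nat \<Rightarrow> nat \<Rightarrow> nat \<Rightarrow> real" where
  "theta k i j = bracket i j i k / orient i k j"

section \<open>Identities between orientations, brackets and plane parameters\<close>

lemma orient_perm:
  "orient i k j = - orient i j k" "orient k i j = orient i j k" "orient j i k = - orient i j k"
  "orient j k i = orient i j k" "orient k j i = - orient i j k"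
  by (simp_all add: orient_def algebra_simps)

lemma bracket_neg: "bracket j i k l = - bracket i j k l" "bracket i j l k = - bracket i j k l"
  by (simp_all add: bracket_def algebra_simps)

text \<open>If \<open>m i \<noteq> m j\<close>, then \<open>bracket i j k l\<close> is
  \<open>m i - m j\<close> times the difference of the third coordinates of the lines
  \<open>k\<close> and \<open>l\<close> at the first coordinate where the projections of
  \<open>i\<close> and \<open>j\<close> cross. Such differences telescope.\<close>

lemma bracket_chain: "bracket i j k l + bracket i j l p = bracket i j k p"
  by (simp add: bracket_def algebra_simps)

lemma bracket_commute: "bracket i j i j = bracket j i j i"
  by (simp add: bracket_def algebra_simps)

text \<open>This decides which of the two parameters is the left end of the window of
  \<open>(i, j)\<close>.\<close>

lemma theta_diff_swap:
  assumes "orient i k j \<noteq> 0"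
  shows "theta k i j - theta k j i = bracket i j i j / orient i k j"
proof -
  have "orient j k i = - orient i k j"
    by (simp add: orient_def algebra_simps)
  moreover have "bracket j i j k = bracket i j i j - bracket i j i k"
    by (simp add: bracket_def algebra_simps)
  ultimately show ?thesis
    by (simp add: theta_def diff_divide_distrib minus_divide_left)
qed

text \<open>Replaces the partner \<open>p\<close> of line \<open>i\<close> by \<open>j\<close>. With
  \<open>P i = (m i, b i)\<close>, the planar vectors \<open>P i - P j\<close>,
  \<open>P i - P k\<close>, \<open>P i - P p\<close> satisfy a linear relation whose coefficients
  are orientations up to sign, and \<open>bracket i _ i k\<close> is linear in such a
  vector.\<close>

lemma orient_mult_theta:
  assumes "orient i k p \<noteq> 0"
  shows "orient i k j * theta k i p =
    bracket i j i k - orient i j p / orient i k p * bracket i k i k"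
proof -
  have "orient i k j * bracket i p i k =
      orient i k p * bracket i j i k - orient i j p * bracket i k i k"
    unfolding orient_def bracket_def by algebra
  then show ?thesis
    using assms by (simp add: theta_def field_simps)
qed

text \<open>Compares planes through different lines \<open>i\<close> and \<open>k\<close>: with the
  weights \<open>orient a _ c\<close>, their parameters differ by a bracket to which
  \<open>bracket_chain\<close> applies. The source is again a linear relation of three planar
  vectors, now based at \<open>(m c, b c)\<close>.\<close>

lemma orient_mult_theta_swap:
  assumes "orient i k c \<noteq> 0"
  shows "orient a i c * theta i k c - orient a k c * theta k i c = bracket a c k i"
proof -
  have "orient a k c * bracket i c i k + orient a i c * bracket k c k i =
      - orient i k c * bracket a c k i"
    unfolding orient_def bracket_def by algebra
  moreover have "orient k i c = - orient i k c"
    by (simp add: orient_def algebra_simps)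
  ultimately show ?thesis
    using assms by (simp add: theta_def field_simps)
qed

text \<open>Two uses of \<open>orient_mult_theta\<close>, whose mixed brackets combine. Only
  brackets of the form \<open>bracket x y x y\<close> remain, and these are the ones with known
  signs later.\<close>

lemma orient_mult_theta_diff:
  assumes "orient i k p \<noteq> 0" "orient j k q \<noteq> 0"
  shows "orient i k j * (theta k j q - theta k i p) =
    orient i j p / orient i k p * bracket i k i k
    + orient j i q / orient j k q * bracket j k j k - bracket i j i j"
proof -
  have "orient j k i = - orient i k j"
    by (simp add: orient_def algebra_simps)
  moreover have "bracket j i j k = bracket i j i j - bracket i j i k"
    by (simp add: bracket_def algebra_simps)
  ultimately show ?thesis
    using orient_mult_theta[OF assms(1), of j] orient_mult_theta[OF assms(2), of i]
    by (simp add: algebra_simps)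
qed


section \<open>Overlapping windows among five lines\<close>

definition window :: "nat \<Rightarrow> nat \<Rightarrow> nat \<Rightarrow> real set" where
  "window k i j = closed_segment (theta k i j) (theta k j i)"

text \<open>Two intervals meet if each left end is at most the right end of the other. For each of
  the middle lines \<open>c\<close>, \<open>d\<close>, \<open>e\<close>, one of these two
  inequalities always holds (\<open>cross\<close>). If the other one failed for all three lines, a
  weighted sum of the gaps would be positive, but it is at most
  \<open>bracket a f a f\<close>.\<close>

lemma five_lines_nonpos:
  assumes convex: "0 < orient a c d" "0 < orient a c e" "0 < orient a c f" "0 < orient a d e"
      "0 < orient a d f" "0 < orient a e f" "0 < orient c d e" "0 < orient c d f"
      "0 < orient c e f" "0 < orient d e f"
    and neg: "\<And>i j. i \<in> {a, c, d, e, f} \<Longrightarrow> j \<in> {a, c, d, e, f} \<Longrightarrow> bracket i j i j \<le> 0"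
  shows "window c a e \<inter> window c d f \<noteq> {} \<or> window d a e \<inter> window d c f \<noteq> {} \<or>
    window e a d \<inter> window e c f \<noteq> {}"
proof -
  have meets: "closed_segment x y \<inter> closed_segment z w \<noteq> {}"
    if "x \<le> w" "z \<le> y" "x \<le> y" "z \<le> w" for x y z w :: real
  proof -
    have "max x z \<in> closed_segment x y \<inter> closed_segment z w"
      using that by (auto simp: closed_segment_eq_real_ivl)
    then show ?thesis by blast
  qed
  \<comment> \<open>These rules bring every orientation into increasing order of the lines, where
    its sign is known.\<close>
  note signs = convex
    orient_perm[where i=a and j=c and k=d] orient_perm[where i=a and j=c and k=e]
    orient_perm[where i=a and j=c and k=f] orient_perm[where i=a and j=d and k=e]
    orient_perm[where i=a and j=d and k=f] orient_perm[where i=a and j=e and k=f]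
    orient_perm[where i=c and j=d and k=e] orient_perm[where i=c and j=d and k=f]
    orient_perm[where i=c and j=e and k=f] orient_perm[where i=d and j=e and k=f]
  have swap: "theta k i j \<le> theta k j i" if "0 < orient i k j" "bracket i j i j \<le> 0" for i j k
  proof -
    have "theta k i j - theta k j i = bracket i j i j / orient i k j"
      using that by (intro theta_diff_swap) simp
    also have "\<dots> \<le> 0"
      using that by (simp add: divide_nonpos_pos)
    finally show ?thesis by simp
  qed
  \<comment> \<open>Under these sign conditions all three summands of
    \<open>orient_mult_theta_diff\<close> are nonnegative.\<close>
  have le: "theta k i p \<le> theta k j q"
    if "orient i j p / orient i k p < 0" "orient j i q / orient j k q < 0" "0 < orient i k j"
      "i \<in> {a, c, d, e, f}" "j \<in> {a, c, d, e, f}" "k \<in> {a, c, d, e, f}" for i j k p q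
  proof -
    have "orient i k p \<noteq> 0" "orient j k q \<noteq> 0"
      using that(1,2) by auto
    moreover have "0 \<le> orient i j p / orient i k p * bracket i k i k"
      "0 \<le> orient j i q / orient j k q * bracket j k j k" "bracket i j i j \<le> 0"
      using mult_nonpos_nonpos[OF less_imp_le[OF that(1)] neg[OF that(4,6)]]
        mult_nonpos_nonpos[OF less_imp_le[OF that(2)] neg[OF that(5,6)]] neg[OF that(4,5)]
      by simp_all
    ultimately have "0 \<le> orient i k j * (theta k j q - theta k i p)"
      by (simp add: orient_mult_theta_diff)
    then show ?thesis
      using that(3) by (simp add: zero_le_mult_iff)
  qed
  have self: "theta c a e \<le> theta c e a" "theta c f d \<le> theta c d f"
    "theta d a e \<le> theta d e a" "theta d c f \<le> theta d f c"
    "theta e d a \<le> theta e a d" "theta e c f \<le> theta e f c"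
    by (rule swap; use neg in \<open>simp add: signs\<close>)+
  have cross: "theta c f d \<le> theta c e a" "theta d a e \<le> theta d f c" "theta e c f \<le> theta e a d"
    using le[of a f e d c] le[of c a f e d] le[of f e d c a]
    by (simp_all add: signs divide_less_0_iff)
  have "theta c a e \<le> theta c d f \<or> theta d c f \<le> theta d e a \<or> theta e d a \<le> theta e f c"
  proof (rule ccontr)
    assume "\<not> ?thesis"
    then have less: "theta c d f < theta c a e" "theta d e a < theta d c f"
      "theta e f c < theta e d a"
      by auto
    txt \<open>Weighted with \<open>orient a _ f\<close>, the three gaps telescope to \<open>bracket a f a f\<close>.\<close>
    have "orient a c f * theta c a e =
        bracket a f a c + orient a e f / orient a c e * bracket a c a c"
      using orient_mult_theta[of a c e f] signs by simp
    moreover have "orient a e f / orient a c e * bracket a c a c \<le> 0"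
      using convex neg[of a c] by (intro mult_nonneg_nonpos) auto
    ultimately have 1: "orient a c f * theta c a e \<le> bracket a f a c"
      by linarith
    have 2: "orient a d f * theta d c f - orient a c f * theta c d f = bracket a f c d"
      using orient_mult_theta_swap[of d c f a] signs by simp
    have 3: "orient a e f * theta e d a - orient a d f * theta d e a = bracket a f d e"
      using orient_mult_theta_swap[of e d a f] bracket_neg[of f a d e] signs by simp
    have "- orient a e f * theta e f c =
        bracket a f e f + orient a c f / orient c e f * bracket f e f e"
      using orient_mult_theta[of f e c a] bracket_neg(1)[of f a f e] bracket_neg(2)[of a f f e] signs
      by simp
    moreover have "orient a c f / orient c e f * bracket f e f e \<le> 0"
      using convex neg[of f e] by (intro mult_nonneg_nonpos) auto
    ultimately have 4: "- orient a e f * theta e f c \<le> bracket a f e f"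
      by linarith
    \<comment> \<open>The left sides of 1 to 4 add up to the three weighted gaps, each of them
      positive; the right sides add up to \<open>bracket a f a f\<close>.\<close>
    have "bracket a f a c + bracket a f c d + bracket a f d e + bracket a f e f = bracket a f a f"
      by (simp add: bracket_chain)
    then have "bracket a f a c + bracket a f c d + bracket a f d e + bracket a f e f \<le> 0"
      using neg[of a f] by simp
    moreover have "0 < orient a c f * (theta c a e - theta c d f)"
      "0 < orient a d f * (theta d c f - theta d e a)"
      "0 < orient a e f * (theta e d a - theta e f c)"
      using less convex by (simp_all add: zero_less_mult_iff)
    ultimately show False
      using 1 2 3 4 by (simp add: algebra_simps)
  qed
  then have
    "closed_segment (theta c a e) (theta c e a) \<inter> closed_segment (theta c f d) (theta c d f) \<noteq> {} \<or>
    closed_segment (theta d a e) (theta d e a) \<inter> closed_segment (theta d c f) (theta d f c) \<noteq> {} \<or>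
    closed_segment (theta e d a) (theta e a d) \<inter> closed_segment (theta e c f) (theta e f c) \<noteq> {}"
    using meets[OF _ cross(1) self(1,2)] meets[OF cross(2) _ self(3,4)]
      meets[OF _ cross(3) self(5,6)] by blast
  then show ?thesis
    unfolding window_def
    using closed_segment_commute[of "theta c f d"] closed_segment_commute[of "theta e d a"] by simp
qed

text \<open>Reflection in the plane \<open>z = 0\<close> negates \<open>u\<close> and
  \<open>v\<close>. It keeps orientations, changes the sign of all brackets and mirrors every
  window, so the second case reduces to the first.\<close>

lemma five_lines:
  assumes "0 < orient a c d" "0 < orient a c e" "0 < orient a c f" "0 < orient a d e"
      "0 < orient a d f" "0 < orient a e f" "0 < orient c d e" "0 < orient c d f"
      "0 < orient c e f" "0 < orient d e f"
    and "(\<forall>i\<in>{a, c, d, e, f}. \<forall>j\<in>{a, c, d, e, f}. bracket i j i j \<le> 0) \<or>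
      (\<forall>i\<in>{a, c, d, e, f}. \<forall>j\<in>{a, c, d, e, f}. 0 \<le> bracket i j i j)"
  shows "window c a e \<inter> window c d f \<noteq> {} \<or> window d a e \<inter> window d c f \<noteq> {} \<or>
    window e a d \<inter> window e c f \<noteq> {}"
  using assms(11)
proof
  assume "\<forall>i\<in>{a, c, d, e, f}. \<forall>j\<in>{a, c, d, e, f}. bracket i j i j \<le> 0"
  then show ?thesis
    using five_lines_nonpos[OF assms(1-10)] by blast
next
  interpret neg: line_family m b "\<lambda>i. - u i" "\<lambda>i. - v i" .
  have bracket: "neg.bracket i j k l = - bracket i j k l" for i j k l
    by (simp add: bracket_def neg.bracket_def algebra_simps)
  have "neg.theta k i j = - theta k i j" for k i j
    by (simp add: theta_def neg.theta_def bracket)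
  then have window: "t \<in> neg.window k i j \<longleftrightarrow> - t \<in> window k i j" for t k i j
    by (auto simp: window_def neg.window_def closed_segment_eq_real_ivl)
  assume "\<forall>i\<in>{a, c, d, e, f}. \<forall>j\<in>{a, c, d, e, f}. 0 \<le> bracket i j i j"
  then have "neg.bracket i j i j \<le> 0" if "i \<in> {a, c, d, e, f}" "j \<in> {a, c, d, e, f}" for i j
    using that by (simp only: bracket neg_le_0_iff_le)
  from neg.five_lines_nonpos[OF assms(1-10) this]
  show ?thesis
    unfolding disjoint_iff window by (metis IntI empty_iff)
qed

definition window_end :: "nat \<Rightarrow> nat \<Rightarrow> nat \<Rightarrow> real" where
  "window_end k i j = min (theta k i j) (theta k j i)"

lemma window_end_in_window: "window_end k i j \<in> window k i j"
  by (auto simp: window_end_def window_def closed_segment_eq_real_ivl)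

text \<open>The larger of the two left ends lies in both intervals. Hence only finitely many
  parameters, one per window, have to be tried.\<close>

lemma windows_meet:
  assumes "window k i j \<inter> window k p q \<noteq> {}"
  shows "window_end k p q \<in> window k i j \<or> window_end k i j \<in> window k p q"
  using assms by (auto simp: window_end_def window_def closed_segment_eq_real_ivl split: if_splits)

text \<open>Stated in the form needed for counting: \<open>(k, p, q)\<close> fixes a plane,
  \<open>(i, j)\<close> is a pair it separates, and together they use up exactly the five elements
  of \<open>T\<close>.\<close>

lemma exists_window_end_in_window:
  assumes "card T = 5"
    and cap: "\<And>i j k. i \<in> T \<Longrightarrow> j \<in> T \<Longrightarrow> k \<in> T \<Longrightarrow> i < j \<Longrightarrow> j < k \<Longrightarrow> 0 < orient i j k"
    and "(\<forall>i\<in>T. \<forall>j\<in>T. bracket i j i j \<le> 0) \<or> (\<forall>i\<in>T. \<forall>j\<in>T. 0 \<le> bracket i j i j)"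
  shows "\<exists>k p q i j. {k, p, q, i, j} = T \<and> p < q \<and> i < j \<and> window_end k p q \<in> window k i j"
proof -
  obtain a c d e f where T: "T = {a, c, d, e, f}" and less: "a < c" "c < d" "d < e" "e < f"
    using assms(1) by (rule card_5_sorted)
  have meets: "window c a e \<inter> window c d f \<noteq> {} \<or> window d a e \<inter> window d c f \<noteq> {} \<or>
    window e a d \<inter> window e c f \<noteq> {}"
    by (rule five_lines; (rule cap)?) (use assms(3) less in \<open>auto simp: T\<close>)
  have pick: ?thesis
    if meet: "window k i j \<inter> window k p q \<noteq> {}" and pairs: "i < j" "p < q"
      and eq: "{k, p, q, i, j} = T"
    for k i j p q
    using windows_meet[OF meet]
  proof
    assume "window_end k p q \<in> window k i j"
    with pairs eq show ?thesis
      by blast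
  next
    assume "window_end k i j \<in> window k p q"
    moreover have "{k, i, j, p, q} = T"
      using eq by (auto simp: insert_commute)
    ultimately show ?thesis
      using pairs by blast
  qed
  have "{c, d, f, a, e} = T" "{d, c, f, a, e} = T" "{e, c, f, a, d} = T"
    by (auto simp: T)
  moreover have "a < e" "a < d" "d < f" "c < f"
    using less by auto
  ultimately show ?thesis
    using meets pick by (elim disjE) simp_all
qed

section \<open>From window parameters to separating planes\<close>

text \<open>The graph of \<open>\<alpha> * x + \<beta> * y + \<gamma>\<close> separates the lines \<open>i\<close> and \<open>j\<close>.\<close>

definition crosses :: "real \<Rightarrow> real \<Rightarrow> real \<Rightarrow> nat \<Rightarrow> nat \<Rightarrow> bool" where
  "crosses \<alpha> \<beta> \<gamma> i j \<longleftrightarrow> (let x = (b j - b i) / (m i - m j); h = \<alpha> * x + \<beta> * (m i * x + b i) + \<gamma>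
     in (u i * x + v i - h) * (u j * x + v j - h) \<le> 0)"

text \<open>Over the crossing of the projections, the heights of the lines \<open>i\<close> and
  \<open>j\<close> above this plane are, up to the factor \<open>m i - m j\<close>, equal to
  \<open>orient i k j\<close> times \<open>theta k i j - t\<close> and
  \<open>theta k j i - t\<close>. For \<open>t\<close> in the window these two differences have a
  nonpositive product.\<close>

lemma window_imp_crosses:
  assumes "t \<in> window k i j" "orient i k j \<noteq> 0" "m i \<noteq> m j"
  shows "crosses (u k - t * m k) t (v k - t * b k) i j"
proof -
  define x where "x = (b j - b i) / (m i - m j)"
  define h where "h = (u k - t * m k) * x + t * (m i * x + b i) + (v k - t * b k)"
  have x: "(m i - m j) * x = b j - b i"
    using assms(3) by (simp add: x_def)
  have theta: "orient i k j * theta k i j = bracket i j i k"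
    "orient i k j * theta k j i = bracket i j j k"
  proof -
    have "orient j k i = - orient i k j" "bracket j i j k = - bracket i j j k"
      by (simp_all add: orient_def bracket_def algebra_simps)
    then show "orient i k j * theta k i j = bracket i j i k"
      "orient i k j * theta k j i = bracket i j j k"
      using assms(2) by (simp_all add: theta_def)
  qed
  have "(m i - m j) * (u i * x + v i - h) = bracket i j i k - t * orient i k j"
    using x unfolding h_def bracket_def orient_def by algebra
  then have i: "(m i - m j) * (u i * x + v i - h) = orient i k j * (theta k i j - t)"
    using theta by (simp add: algebra_simps)
  have "(m i - m j) * (u j * x + v j - h) = bracket i j j k - t * orient i k j"
    using x unfolding h_def bracket_def orient_def by algebra
  then have j: "(m i - m j) * (u j * x + v j - h) = orient i k j * (theta k j i - t)"
    using theta by (simp add: algebra_simps)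
  have "(theta k i j - t) * (theta k j i - t) \<le> 0"
    using assms(1)
    by (auto simp: window_def closed_segment_eq_real_ivl mult_le_0_iff split: if_splits)
  then have "(orient i k j)\<^sup>2 * ((theta k i j - t) * (theta k j i - t)) \<le> 0"
    by (simp add: mult_nonneg_nonpos)
  also have "(orient i k j)\<^sup>2 * ((theta k i j - t) * (theta k j i - t)) =
      (m i - m j)\<^sup>2 * ((u i * x + v i - h) * (u j * x + v j - h))"
    using i j unfolding power2_eq_square by algebra
  finally have "(u i * x + v i - h) * (u j * x + v j - h) \<le> 0"
    using assms(3) by (simp add: mult_le_0_iff)
  then show ?thesis
    by (simp add: crosses_def Let_def x_def h_def)
qed

lemma orient_nonzero:
  assumes cap: "\<And>i j k. 1 \<le> i \<Longrightarrow> i < j \<Longrightarrow> j < k \<Longrightarrow> k \<le> n \<Longrightarrow> 0 < orient i j k"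
    and "distinct [i, j, k]" "{i, j, k} \<subseteq> {1..n}"
  shows "orient i j k \<noteq> 0"
proof -
  consider "i < j" "j < k" | "i < k" "k < j" | "j < i" "i < k" | "j < k" "k < i"
    | "k < i" "i < j" | "k < j" "j < i"
    using assms(2) by fastforce
  then show ?thesis
    using cap[of i j k] cap[of i k j] cap[of j i k] cap[of j k i] cap[of k i j] cap[of k j i]
      orient_perm[where i=i and j=j and k=k] assms(3)
    by cases auto
qed

text \<open>The plane depends on \<open>k\<close> and \<open>t\<close> alone, so a single one serves
  all windows of \<open>k\<close> that contain \<open>t\<close>.\<close>

lemma windows_crossed:
  assumes cap: "\<And>i j k. 1 \<le> i \<Longrightarrow> i < j \<Longrightarrow> j < k \<Longrightarrow> k \<le> n \<Longrightarrow> 0 < orient i j k"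
    and slopes: "\<And>i j. 1 \<le> i \<Longrightarrow> i < j \<Longrightarrow> j \<le> n \<Longrightarrow> m i \<noteq> m j"
    and "k \<in> {1..n}"
  shows "\<exists>\<alpha> \<beta> \<gamma>. \<forall>i j. 1 \<le> i \<and> i < j \<and> j \<le> n \<and> i \<noteq> k \<and> j \<noteq> k \<and> t \<in> window k i j \<longrightarrow>
    crosses \<alpha> \<beta> \<gamma> i j"
proof (intro exI allI impI)
  fix i j assume ij: "1 \<le> i \<and> i < j \<and> j \<le> n \<and> i \<noteq> k \<and> j \<noteq> k \<and> t \<in> window k i j"
  then have "orient i k j \<noteq> 0"
    using assms(3) by (intro orient_nonzero[OF cap]) auto
  then show "crosses (u k - t * m k) t (v k - t * b k) i j"
    using ij slopes[of i j] by (intro window_imp_crosses) auto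
qed

end

subsection \<open>Separating many pairs\<close>

lemma many_crossed_pairs:
  "\<exists>c>0. \<forall>n m b u v. 3 \<le> n \<longrightarrow>
     (\<forall>i j k. 1 \<le> i \<and> i < j \<and> j < k \<and> k \<le> n \<longrightarrow> 0 < line_family.orient m b i j k) \<longrightarrow>
     (\<forall>i j. 1 \<le> i \<and> i < j \<and> j \<le> n \<longrightarrow> m i \<noteq> m j) \<longrightarrow>
     (\<exists>\<alpha> \<beta> \<gamma>. c * (real n)\<^sup>2 \<le>
        real (card {(i, j). 1 \<le> i \<and> i < j \<and> j \<le> n \<and> line_family.crosses m b u v \<alpha> \<beta> \<gamma> i j}))"
proof -
  obtain r where ramsey: "\<forall>(V :: nat set) P. finite V \<and> r \<le> card V \<and> symp P \<longrightarrow>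
    (\<exists>R\<subseteq>V. card R = 5 \<and> (\<forall>x\<in>R. \<forall>y\<in>R. x \<noteq> y \<longrightarrow> P x y) \<or>
           card R = 5 \<and> (\<forall>x\<in>R. \<forall>y\<in>R. x \<noteq> y \<longrightarrow> \<not> P x y))"
    using ramsey_symp[where 'a = nat and m = 5 and n = 5] by (elim exE)
  define s where "s = max r 5"
  define C where "C = 5 ^ 5 * real (s choose 5)"
  \<comment> \<open>The bound \<open>1 / C\<close> serves the case \<open>s \<le> n\<close>, the
    bound \<open>1 / s^2\<close> the case \<open>n < s\<close>.\<close>
  define c where "c = 1 / (C + (real s)\<^sup>2)"
  have s: "r \<le> s" "5 \<le> s"
    by (auto simp: s_def)
  then have "0 < C"
    by (simp add: C_def)
  have "0 < (real s)\<^sup>2"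
    using s by simp
  have "0 < c"
    using add_pos_pos[OF \<open>0 < C\<close> \<open>0 < (real s)\<^sup>2\<close>] by (simp add: c_def)
  have c_le: "c \<le> 1 / C" "c \<le> 1 / (real s)\<^sup>2"
    unfolding c_def using \<open>0 < C\<close> \<open>0 < (real s)\<^sup>2\<close> by (intro frac_le; simp)+
  show ?thesis
  proof (rule exI[of _ c], intro conjI allI impI)
    fix n :: nat and m b u v :: "nat \<Rightarrow> real"
    interpret line_family m b u v .
    assume n: "3 \<le> n"
    assume "\<forall>i j k. 1 \<le> i \<and> i < j \<and> j < k \<and> k \<le> n \<longrightarrow> 0 < orient i j k"
    then have cap: "0 < orient i j k" if "1 \<le> i" "i < j" "j < k" "k \<le> n" for i j k
      using that by blast
    assume "\<forall>i j. 1 \<le> i \<and> i < j \<and> j \<le> n \<longrightarrow> m i \<noteq> m j"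
    then have slopes: "m i \<noteq> m j" if "1 \<le> i" "i < j" "j \<le> n" for i j
      using that by blast
    \<comment> \<open>Pairs containing \<open>k\<close> are left out: there the orientation vanishes
      and \<open>theta\<close> is the meaningless default 0.\<close>
    define W where "W k t =
      {(i, j). 1 \<le> i \<and> i < j \<and> j \<le> n \<and> i \<noteq> k \<and> j \<noteq> k \<and> t \<in> window k i j}" for k t
    define X where "X \<alpha> \<beta> \<gamma> = {(i, j). 1 \<le> i \<and> i < j \<and> j \<le> n \<and> crosses \<alpha> \<beta> \<gamma> i j}" for \<alpha> \<beta> \<gamma>
    have fin: "finite (X \<alpha> \<beta> \<gamma>)" "finite (W k t)" for \<alpha> \<beta> \<gamma> k t
      by (rule finite_subset[of _ "{1..n} \<times> {1..n}"]; auto simp: X_def W_def)+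
    have goal: "\<exists>\<alpha> \<beta> \<gamma>. c * (real n)\<^sup>2 \<le> real (card (X \<alpha> \<beta> \<gamma>))"
      if k: "k \<in> {1..n}" and large: "c * (real n)\<^sup>2 \<le> real (card (W k t))" for k t
    proof -
      obtain \<alpha> \<beta> \<gamma> where "W k t \<subseteq> X \<alpha> \<beta> \<gamma>"
        using windows_crossed[OF cap slopes k, of t] unfolding W_def X_def by blast
      then have "card (W k t) \<le> card (X \<alpha> \<beta> \<gamma>)"
        using fin by (intro card_mono)
      then show ?thesis
        using large by (meson of_nat_le_iff order_trans)
    qed
    have "\<exists>\<alpha> \<beta> \<gamma>. c * (real n)\<^sup>2 \<le> real (card (X \<alpha> \<beta> \<gamma>))"
    proof (cases "s \<le> n")
      case False
      \<comment> \<open>Here \<open>c * n^2\<close> is at most 1, so one separated pair is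
        enough.\<close>
      have "(1, 2) \<in> W 3 (window_end 3 1 2)"
        using n by (simp add: W_def window_end_in_window)
      then have "1 \<le> card (W 3 (window_end 3 1 2))"
        using fin by (metis One_nat_def Suc_leI card_gt_0_iff empty_iff)
      moreover have "c * (real n)\<^sup>2 \<le> 1"
      proof -
        have "c * (real n)\<^sup>2 \<le> 1 / (real s)\<^sup>2 * (real s)\<^sup>2"
          using c_le(2) False \<open>0 < c\<close> by (intro mult_mono power_mono) auto
        then show ?thesis
          using \<open>0 < (real s)\<^sup>2\<close> by simp
      qed
      ultimately show ?thesis
        using n by (intro goal[of 3 "window_end 3 1 2"]) auto
    next
      case True
      \<comment> \<open>The key \<open>(k, p, q)\<close> fixes the plane and the cardinality 5
        forces all indices to be distinct. There are \<open>n^3\<close> keys against order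
        \<open>n^5\<close> quintuples, so some key receives order \<open>n^2\<close> pairs.\<close>
      define Q where "Q = (\<lambda>(k, p, q) (i, j). card {k, p, q, i, j} = 5 \<and> {k, p, q, i, j} \<subseteq> {1..n} \<and>
        i < j \<and> window_end k p q \<in> window k i j)"
      define supp where "supp = (\<lambda>(k, p, q) (i, j). {k, p, q, i, j :: nat})"
      have "\<exists>x\<in>{1..n} \<times> {1..n} \<times> {1..n}. card {1..n} choose 5 \<le>
        card ({1..n} \<times> {1..n} \<times> {1..n}) * (s choose 5) * card {e\<in>{1..n} \<times> {1..n}. Q x e}"
      proof (rule supersaturation[where supp = supp])
        show "supp x e \<subseteq> {1..n} \<and> card (supp x e) = 5" if "Q x e" for x e
          using that by (auto simp: Q_def supp_def split: prod.splits)
      next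
        fix S assume S: "S \<subseteq> {1..n}" "card S = s"
        then have "finite S"
          using finite_subset by blast
        moreover have "symp (\<lambda>i j. bracket i j i j \<le> 0)"
          by (simp add: symp_def bracket_commute)
        ultimately obtain T where T: "T \<subseteq> S" "card T = 5" and
          "(\<forall>i\<in>T. \<forall>j\<in>T. i \<noteq> j \<longrightarrow> bracket i j i j \<le> 0) \<or> (\<forall>i\<in>T. \<forall>j\<in>T. i \<noteq> j \<longrightarrow> \<not> bracket i j i j \<le> 0)"
          using ramsey[rule_format, of S "\<lambda>i j. bracket i j i j \<le> 0"] s S by blast
        moreover have "bracket i i i i = 0" for i
          by (simp add: bracket_def)
        ultimately have "(\<forall>i\<in>T. \<forall>j\<in>T. bracket i j i j \<le> 0) \<or> (\<forall>i\<in>T. \<forall>j\<in>T. 0 \<le> bracket i j i j)"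
          by (metis linorder_linear order_refl)
        moreover have "0 < orient i j k" if "i \<in> T" "j \<in> T" "k \<in> T" "i < j" "j < k" for i j k
          using that T S by (intro cap) auto
        ultimately obtain k p q i j where "{k, p, q, i, j} = T" "p < q" "i < j"
          "window_end k p q \<in> window k i j"
          using exists_window_end_in_window[OF T(2)] by blast
        then have "Q (k, p, q) (i, j)" "supp (k, p, q) (i, j) \<subseteq> S" "{k, p, q, i, j} \<subseteq> {1..n}"
          using T S by (auto simp: Q_def supp_def)
        then show "\<exists>x\<in>{1..n} \<times> {1..n} \<times> {1..n}. \<exists>e\<in>{1..n} \<times> {1..n}. Q x e \<and> supp x e \<subseteq> S"
          by (intro bexI[of _ "(k, p, q)"] bexI[of _ "(i, j)"]) auto
      qed (use s True in auto)
      then obtain k p q where k: "k \<in> {1..n}" and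
        "n choose 5 \<le> n ^ 3 * (s choose 5) * card {e\<in>{1..n} \<times> {1..n}. Q (k, p, q) e}"
        by (auto simp: card_cartesian_product power3_eq_cube mult.assoc)
      note this(2)
      also have "card {e\<in>{1..n} \<times> {1..n}. Q (k, p, q) e} \<le> card (W k (window_end k p q))"
      proof (rule card_mono[OF fin(2)], rule subsetI)
        fix e assume "e \<in> {e\<in>{1..n} \<times> {1..n}. Q (k, p, q) e}"
        then obtain i j where e: "e = (i, j)" and Q: "Q (k, p, q) (i, j)"
          by (cases e) auto
        have "i \<noteq> k \<and> j \<noteq> k"
        proof (rule ccontr)
          assume "\<not> (i \<noteq> k \<and> j \<noteq> k)"
          then have "{k, p, q, i, j} = set [p, q, i, j]"
            by auto
          also have "card \<dots> \<le> 4"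
            using card_length[of "[p, q, i, j]"] by simp
          finally have "card {k, p, q, i, j} \<le> 4" .
          then show False
            using Q by (simp add: Q_def)
        qed
        then show "e \<in> W k (window_end k p q)"
          using Q by (auto simp: e Q_def W_def)
      qed
      finally have "n choose 5 \<le> n ^ 3 * (s choose 5) * card (W k (window_end k p q))"
        (is "_ \<le> _ * ?w")
        by simp
      then have "real (n choose 5) \<le> real (n ^ 3 * (s choose 5) * ?w)"
        by (simp only: of_nat_le_iff)
      \<comment> \<open>Dividing by \<open>n^3\<close> leaves \<open>n^2\<close>; this bound is the
        source of the factor \<open>5 ^ 5\<close> in \<open>C\<close>.\<close>
      moreover have "(real n / 5) ^ 5 \<le> real (n choose 5)"
        using binomial_ge_n_over_k_pow_k[of 5 n, where 'a = real] s True by simp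
      ultimately have "(real n / 5) ^ 5 \<le> real n ^ 3 * real (s choose 5) * real ?w"
        by simp
      then have "real n ^ 3 * (real n)\<^sup>2 \<le> real n ^ 3 * (C * real ?w)"
        by (simp add: C_def power_divide field_simps flip: power_add)
      then have "(real n)\<^sup>2 \<le> C * real ?w"
        by (rule mult_left_le_imp_le) (use n in simp)
      then have "1 / C * (real n)\<^sup>2 \<le> real ?w"
        using \<open>0 < C\<close> by (simp add: field_simps)
      then have "c * (real n)\<^sup>2 \<le> real ?w"
        using c_le(1) by (meson mult_right_mono order_trans zero_le_power2)
      then show ?thesis
        using k by (intro goal)
    qed
    then show "\<exists>\<alpha> \<beta> \<gamma>. c * (real n)\<^sup>2 \<le>
        real (card {(i, j). 1 \<le> i \<and> i < j \<and> j \<le> n \<and> crosses \<alpha> \<beta> \<gamma> i j})"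
      by (simp add: X_def)
  qed (use \<open>0 < c\<close> in simp)
qed

text \<open>The second factor is the signed height of the crossing of \<open>i\<close> and
  \<open>k\<close> above line \<open>j\<close> in the projection. In a cap both factors are positive
  and in a cup both are negative, so the orientation is positive in either case.\<close>

lemma orient_eq_height_diff:
  fixes m b :: "nat \<Rightarrow> real"
  assumes "m i \<noteq> m k"
  defines "x \<equiv> (b k - b i) / (m i - m k)"
  shows "line_family.orient m b i j k = (m i - m k) * (m i * x + b i - (m j * x + b j))"
proof -
  have "(m i - m k) * x = b k - b i"
    using assms by simp
  then show ?thesis
    unfolding line_family.orient_def by algebra
qed

theorem theorem2p4:
  "\<exists>c::real. c > 0 \<and>
     (\<forall>(n::nat) (l :: nat \<Rightarrow> (real^3) set). n \<ge> 3 \<longrightarrow> monotone_lines n l \<longrightarrow>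
        (\<exists>H. nonvertical_plane H \<and>
           real (card {(i, j). 1 \<le> i \<and> i < j \<and> j \<le> n \<and> separates H (l i) (l j)})
             \<ge> c * (real n)\<^sup>2))"
proof -
  obtain c :: real where "c > 0" and c: "\<And>n m b u v. 3 \<le> n \<Longrightarrow>
     (\<forall>i j k. 1 \<le> i \<and> i < j \<and> j < k \<and> k \<le> n \<longrightarrow> 0 < line_family.orient m b i j k) \<Longrightarrow>
     (\<forall>i j. 1 \<le> i \<and> i < j \<and> j \<le> n \<longrightarrow> m i \<noteq> m j) \<Longrightarrow>
     \<exists>\<alpha> \<beta> \<gamma>. c * (real n)\<^sup>2 \<le>
        real (card {(i, j). 1 \<le> i \<and> i < j \<and> j \<le> n \<and> line_family.crosses m b u v \<alpha> \<beta> \<gamma> i j})"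
    using many_crossed_pairs by blast
  show ?thesis
  proof (intro exI[of _ c] conjI allI impI)
    fix n :: nat and l :: "nat \<Rightarrow> (real^3) set"
    assume n: "3 \<le> n" and mono: "monotone_lines n l"
    then have cap_cup: "is_cap n (\<lambda>i. vproj ` l i) \<or> is_cup n (\<lambda>i. vproj ` l i)"
      by (simp add: monotone_lines_def)
    have "\<exists>m b u v. l i = graph_line3 m b u v" if "i \<in> {1..n}" for i
    proof -
      have "is_line (l i)"
        using mono that by (simp add: monotone_lines_def nonvertical_line3_def)
      moreover have "nonvertical_line2 (vproj ` l i)"
        using cap_cup that by (auto simp: is_cap_def is_cup_def)
      ultimately show ?thesis
        by (metis line_eq_graph_line3)
    qed
    then obtain m b u v where l: "\<And>i. i \<in> {1..n} \<Longrightarrow> l i = graph_line3 (m i) (b i) (u i) (v i)"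
      by metis
    then have proj: "vproj ` l i = graph_line2 (m i) (b i)" if "1 \<le> i" "i \<le> n" for i
      using that by (simp add: vproj_image_graph_line3)
    have slopes: "m i \<noteq> m j" if "1 \<le> i" "i < j" "j \<le> n" for i j
      using cap_cup
    proof
      assume "is_cap n (\<lambda>i. vproj ` l i)"
      then have "slope (vproj ` l j) < slope (vproj ` l i)"
        using that by (simp add: is_cap_def)
      then show ?thesis
        using that by (simp add: proj)
    next
      assume "is_cup n (\<lambda>i. vproj ` l i)"
      then have "slope (vproj ` l i) < slope (vproj ` l j)"
        using that by (simp add: is_cup_def)
      then show ?thesis
        using that by (simp add: proj)
    qed
    have orient: "0 < line_family.orient m b i j k" if "1 \<le> i" "i < j" "j < k" "k \<le> n" for i j k
    proof -
      define x where "x = (b k - b i) / (m i - m k)"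
      have "m i \<noteq> m k"
        using that by (intro slopes) auto
      then have eq: "line_family.orient m b i j k = (m i - m k) * (m i * x + b i - (m j * x + b j))"
        and inter: "vproj ` l i \<inter> vproj ` l k = {vector [x, m i * x + b i]}"
        using that by (simp_all add: orient_eq_height_diff proj graph_line2_inter_point x_def)
      from cap_cup show ?thesis
      proof
        assume cap: "is_cap n (\<lambda>i. vproj ` l i)"
        then have "slope (vproj ` l k) < slope (vproj ` l i)"
          using that by (simp add: is_cap_def)
        moreover have "pt_above (vector [x, m i * x + b i]) (vproj ` l j)"
          \<comment> \<open>The point provided by the cap condition is the computed crossing,
            because the intersection is a singleton.\<close>
          using cap that inter unfolding is_cap_def by (metis singleton_inject)
        ultimately show ?thesis
          using that by (simp add: eq proj pt_above_graph_line2)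
      next
        assume cup: "is_cup n (\<lambda>i. vproj ` l i)"
        then have "slope (vproj ` l i) < slope (vproj ` l k)"
          using that by (simp add: is_cup_def)
        moreover have "pt_below (vector [x, m i * x + b i]) (vproj ` l j)"
          using cup that inter unfolding is_cup_def by (metis singleton_inject)
        ultimately show ?thesis
          using that by (simp add: eq proj pt_below_graph_line2 mult_neg_neg)
      qed
    qed
    have "\<exists>\<alpha> \<beta> \<gamma>. c * (real n)\<^sup>2 \<le>
        real (card {(i, j). 1 \<le> i \<and> i < j \<and> j \<le> n \<and> line_family.crosses m b u v \<alpha> \<beta> \<gamma> i j})"
      using n orient slopes by (intro c) auto
    then obtain \<alpha> \<beta> \<gamma> where "c * (real n)\<^sup>2 \<le>
        real (card {(i, j). 1 \<le> i \<and> i < j \<and> j \<le> n \<and> line_family.crosses m b u v \<alpha> \<beta> \<gamma> i j})"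
      by blast
    also have "\<dots> \<le> real (card {(i, j). 1 \<le> i \<and> i < j \<and> j \<le> n \<and>
        separates (graph_plane \<alpha> \<beta> \<gamma>) (l i) (l j)})"
    proof (intro of_nat_mono card_mono)
      show "finite {(i, j). 1 \<le> i \<and> i < j \<and> j \<le> n \<and> separates (graph_plane \<alpha> \<beta> \<gamma>) (l i) (l j)}"
        by (rule finite_subset[of _ "{1..n} \<times> {1..n}"]) auto
      have "separates (graph_plane \<alpha> \<beta> \<gamma>) (l i) (l j)"
        if "1 \<le> i" "i < j" "j \<le> n" "line_family.crosses m b u v \<alpha> \<beta> \<gamma> i j" for i j
      proof -
        have "l i = graph_line3 (m i) (b i) (u i) (v i)" "l j = graph_line3 (m j) (b j) (u j) (v j)"
          using that l by auto
        then show ?thesis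
          using that slopes[of i j]
          by (auto simp: line_family.crosses_def Let_def intro!: separates_graph_plane)
      qed
      then show "{(i, j). 1 \<le> i \<and> i < j \<and> j \<le> n \<and> line_family.crosses m b u v \<alpha> \<beta> \<gamma> i j} \<subseteq>
        {(i, j). 1 \<le> i \<and> i < j \<and> j \<le> n \<and> separates (graph_plane \<alpha> \<beta> \<gamma>) (l i) (l j)}"
        by blast
    qed
    finally show "\<exists>H. nonvertical_plane H \<and> c * (real n)\<^sup>2 \<le>
        real (card {(i, j). 1 \<le> i \<and> i < j \<and> j \<le> n \<and> separates H (l i) (l j)})"
      using nonvertical_plane_graph_plane by blast
  qed (use \<open>c > 0\<close> in simp)
qed

end
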